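(* Let $\mathbf{F}$ be a field of characteristic $3$. For any $x,y\in\mathfrak{sl}_3(\mathbf{F})$, the following identity holds in $\mathfrak{psl}_3(\mathbf{F})$: $$[x,y,y] = -\operatorname{Tr}(y^2)\,x + \operatorname{Tr}(xy)\,y.$$
   Context: $\mathfrak{sl}_3(\mathbf{F})$ is the Lie algebra of traceless $3\times3$ matrices over $\mathbf{F}$ with bracket $[x,y]=xy-yx$, and $\mathfrak{psl}_3(\mathbf{F})$ is its quotient by the central ideal of scalar multiples of the identity (which are traceless in characteristic $3$). Brackets are left-normed: $[x,y,y]=[[x,y],y]$. $\operatorname{Tr}$ is the matrix trace. That the identity holds in $\mathfrak{psl}_3(\mathbf{F})$ means that the two sides, computed with the matrices $x,y$, are equal modulo scalar matrices. *)

theory Defs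
  imports "HOL-Analysis.Analysis"
begin

definition sl3 :: "('a::field ^ 3 ^ 3) set"
  where "sl3 = {x. trace x = 0}"

(* The operation * on the type vec is componentwise; the matrix product is **. *)
definition lie_bracket :: "'a::field ^ 3 ^ 3 \<Rightarrow> 'a ^ 3 ^ 3 \<Rightarrow> 'a ^ 3 ^ 3"
  where "lie_bracket x y = x ** y - y ** x"

(* The operation *s would expect a scalar of type 'a ^ 3 for a matrix of type 'a ^ 3 ^ 3. *)
definition matrix_smult :: "'a::field \<Rightarrow> 'a ^ 3 ^ 3 \<Rightarrow> 'a ^ 3 ^ 3"
  where "matrix_smult c x = map_matrix (\<lambda>a. c * a) x"

definition scalar_matrices :: "('a::field ^ 3 ^ 3) set"
  where "scalar_matrices = range mat"

lemma scalar_matrices_subset_sl3: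
  assumes "CHAR('a::field) = 3"
  shows "(scalar_matrices :: ('a ^ 3 ^ 3) set) \<subseteq> sl3"
proof -
  have "(3 :: 'a) = 0"
    using of_nat_CHAR[where 'a = 'a] assms by simp
  then show ?thesis
    by (auto simp: scalar_matrices_def sl3_def trace_def mat_def)
qed

(* In characteristic 3, the canonical projection from sl3 onto psl3 = sl3 / scalar_matrices,
   whose elements are represented by cosets. *)
definition psl3_proj :: "'a::field ^ 3 ^ 3 \<Rightarrow> ('a ^ 3 ^ 3) set"
  where "psl3_proj x = x +o scalar_matrices"

lemma psl3_proj_eq_iff:
  "psl3_proj x = psl3_proj y \<longleftrightarrow> x - y \<in> scalar_matrices"
proof
  assume eq: "psl3_proj x = psl3_proj y"
  have "mat 0 = (0 :: 'a ^ 3 ^ 3)"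
    by (simp add: mat_def vec_eq_iff)
  then have "x \<in> psl3_proj x"
    unfolding psl3_proj_def elt_set_plus_def scalar_matrices_def
    by (metis (mono_tags, lifting) add_0_right mem_Collect_eq rangeI)
  then show "x - y \<in> scalar_matrices"
    unfolding eq by (auto simp: psl3_proj_def elt_set_plus_def)
next
  have add: "mat a + mat b = (mat (a + b) :: 'a ^ 3 ^ 3)" for a b
    by (simp add: mat_def vec_eq_iff)
  have diff: "mat b - mat a = (mat (b - a) :: 'a ^ 3 ^ 3)" for a b
    by (simp add: mat_def vec_eq_iff)
  assume "x - y \<in> scalar_matrices"
  then obtain c where "x - y = mat c"
    by (auto simp: scalar_matrices_def)
  then have x: "x = y + mat c"
    by (simp add: algebra_simps)
  have "y + mat b = x + mat (b - c)" and "x + mat b = y + mat (c + b)" for b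
    unfolding x add[symmetric] diff[symmetric] by simp_all
  then show "psl3_proj x = psl3_proj y"
    by (fastforce simp: psl3_proj_def elt_set_plus_def scalar_matrices_def)
qed

end

theory Submission
  imports Defs
begin

text \<open>
  Every traceless \<open>3 \<times> 3\<close> matrix \<open>y\<close> satisfies \<open>2 y\<^sup>3 = Tr(y\<^sup>2) y + 2 det(y) 1\<close> by the
  Cayley--Hamilton theorem, since twice the second elementary symmetric function of its
  eigenvalues is \<open>- Tr(y\<^sup>2)\<close>. In characteristic \<open>3\<close>, where \<open>2 = - 1\<close>, this says that
  \<open>y\<^sup>3 = - Tr(y\<^sup>2) y\<close> modulo scalar matrices (lemma \<open>cube_traceless_char_3\<close>). The theorem is the
  polarisation of this cubic identity: the part of \<open>(x + y)\<^sup>3\<close> linear in \<open>x\<close> is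
  \<open>x y\<^sup>2 + y x y + y\<^sup>2 x\<close>, which in characteristic \<open>3\<close> equals
  \<open>x y\<^sup>2 - 2 y x y + y\<^sup>2 x = [x, y, y]\<close>, and the part of \<open>- Tr((x + y)\<^sup>2) (x + y)\<close> linear in \<open>x\<close> is
  \<open>- Tr(y\<^sup>2) x - 2 Tr(x y) y = - Tr(y\<^sup>2) x + Tr(x y) y\<close>.
  Lemma \<open>polarised_cube_char_3\<close> extracts this part from the cubes of \<open>x\<close>, \<open>x + y\<close> and \<open>x - y\<close>,
  all of which are traceless.
\<close>

text \<open>
  The factor \<open>2\<close> avoids a division, so that the identity holds in every characteristic. Once the
  trace condition is used to eliminate the last diagonal entry, it is a polynomial identity in the
  remaining eight entries.
\<close>
lemma Cayley_Hamilton_traceless_3: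
  fixes y :: "'a::field ^ 3 ^ 3"
  assumes "trace y = 0"
  shows "2 * (y ** y ** y) $ i $ j = trace (y ** y) * y $ i $ j + 2 * mat (det y) $ i $ j"
proof -
  have y33: "y $ 3 $ 3 = - y $ 1 $ 1 - y $ 2 $ 2"
    using assms by (simp add: trace_def sum_3 eq_neg_iff_add_eq_0 algebra_simps)
  have "\<forall>i j. 2 * (y ** y ** y) $ i $ j = trace (y ** y) * y $ i $ j + 2 * mat (det y) $ i $ j"
    unfolding forall_3
    by (simp add: matrix_matrix_mult_def trace_def sum_3 det_3 mat_def y33)
      (intro conjI; algebra)
  then show ?thesis by blast
qed

lemma cube_traceless_char_3:
  fixes y :: "'a::field ^ 3 ^ 3"
  assumes char: "(3 :: 'a) = 0" and "trace y = 0"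
  shows "(y ** y ** y) $ i $ j = mat (det y) $ i $ j - trace (y ** y) * y $ i $ j"
proof -
  have "(y ** y ** y) $ i $ j - (mat (det y) $ i $ j - trace (y ** y) * y $ i $ j)
      = 3 * ((y ** y ** y) $ i $ j - mat (det y) $ i $ j)"
    using Cayley_Hamilton_traceless_3[OF assms(2), of i j] by algebra
  then show ?thesis
    by (simp add: char)
qed

lemma matrix_add_distrib_right: "(A + B) ** C = A ** C + B ** C"
  for A B :: "'a::semiring_1 ^ 'm ^ 'n"
  by (simp add: vec_eq_iff matrix_matrix_mult_def distrib_right sum.distrib)

lemma matrix_diff_distrib_right: "(A - B) ** C = A ** C - B ** C"
  for A B :: "'a::ring_1 ^ 'm ^ 'n"
  by (simp add: vec_eq_iff matrix_matrix_mult_def left_diff_distrib sum_subtractf)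

lemma matrix_diff_distrib_left: "A ** (B - C) = A ** B - A ** C"
  for A :: "'a::ring_1 ^ 'm ^ 'n"
  by (simp add: vec_eq_iff matrix_matrix_mult_def right_diff_distrib sum_subtractf)

text \<open>
  Modulo \<open>3\<close>, summing \<open>(x + k y)\<^sup>3\<close> over \<open>k = 0, 1, -1\<close> isolates the part of degree \<open>2\<close> in \<open>y\<close>,
  because the sum of \<open>k\<^sup>n\<close> is \<open>0\<close> for \<open>n = 0, 1, 3\<close> and \<open>- 1\<close> for \<open>n = 2\<close>.
\<close>
lemma polarised_cube_char_3:
  fixes x y :: "'a::field ^ 3 ^ 3"
  assumes char: "(3 :: 'a) = 0"
  shows "lie_bracket (lie_bracket x y) y $ i $ j =
    - (((x + y) ** (x + y) ** (x + y)) $ i $ j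
      + ((x - y) ** (x - y) ** (x - y)) $ i $ j + (x ** x ** x) $ i $ j)"
    (is "?L = ?R")
proof -
  have "?L - ?R = 3 * ((x ** x ** x) $ i $ j + (x ** y ** y) $ i $ j + (y ** y ** x) $ i $ j)"
    by (simp add: lie_bracket_def matrix_add_ldistrib matrix_add_distrib_right
        matrix_diff_distrib_left matrix_diff_distrib_right matrix_mul_assoc)
  then show ?thesis
    by (simp add: char)
qed

theorem proposition6p2:
  fixes x y :: "'a::field ^ 3 ^ 3"
  assumes "CHAR('a) = 3"
    and "x \<in> sl3" and "y \<in> sl3"
  shows "psl3_proj (lie_bracket (lie_bracket x y) y) =
    psl3_proj (matrix_smult (- trace (y ** y)) x + matrix_smult (trace (x ** y)) y)"
proof -
  have char: "(3 :: 'a) = 0"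
    using of_nat_CHAR[where 'a = 'a] assms(1) by simp
  have tr: "trace x = 0" "trace y = 0" "trace (x + y) = 0" "trace (x - y) = 0"
    using assms(2,3) by (simp_all add: sl3_def trace_add trace_sub)
  have tr_plus: "trace ((x + y) ** (x + y)) = trace (x ** x) + 2 * trace (x ** y) + trace (y ** y)"
    by (simp add: matrix_add_ldistrib matrix_add_distrib_right trace_add trace_mul_sym[of y x])
  have tr_minus: "trace ((x - y) ** (x - y)) = trace (x ** x) - 2 * trace (x ** y) + trace (y ** y)"
    by (simp add: matrix_diff_distrib_left matrix_diff_distrib_right trace_sub trace_mul_sym[of y x])
  define c where "c = - (det (x + y) + det (x - y) + det x)"
  have "lie_bracket (lie_bracket x y) y $ i $ j
      - (- trace (y ** y) * x $ i $ j + trace (x ** y) * y $ i $ j) = mat c $ i $ j" for i j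
  proof -
    have mat_c: "mat c $ i $ j =
        - (mat (det (x + y)) $ i $ j + mat (det (x - y)) $ i $ j + mat (det x) $ i $ j)"
      by (simp add: c_def mat_def)
    have "lie_bracket (lie_bracket x y) y $ i $ j
        - (- trace (y ** y) * x $ i $ j + trace (x ** y) * y $ i $ j) - mat c $ i $ j
      = 3 * (trace (x ** x) * x $ i $ j + trace (y ** y) * x $ i $ j + trace (x ** y) * y $ i $ j)"
      unfolding polarised_cube_char_3[OF char] cube_traceless_char_3[OF char tr(1)]
        cube_traceless_char_3[OF char tr(3)] cube_traceless_char_3[OF char tr(4)]
        tr_plus tr_minus mat_c vector_add_component vector_minus_component
      by (simp add: algebra_simps)
    then show ?thesis
      by (simp add: char)
  qed
  then have "lie_bracket (lie_bracket x y) y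
      - (matrix_smult (- trace (y ** y)) x + matrix_smult (trace (x ** y)) y) = mat c"
    by (simp add: vec_eq_iff matrix_smult_def map_matrix_def)
  then show ?thesis
    unfolding psl3_proj_eq_iff scalar_matrices_def by blast
qed

end
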